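(* Let $h\in\mathbb{R}[x_1,\dots,x_n]$ be hyperbolic with respect to $\mathbf{e}$ with open hyperbolicity cone $\Lambda_{++}=\Lambda_{++}(h,\mathbf{e})$, and let $\mathbf{v}_1,\dots,\mathbf{v}_m\in\Lambda_+(h,\mathbf{e})$. Then the polynomial $h[\mathbf{v}_1,\dots,\mathbf{v}_m]\in\mathbb{R}[x_1,\dots,x_n,y_1,\dots,y_m]$ is hyperbolic (with respect to $(\mathbf{e},0,\dots,0)$), and its hyperbolicity cone contains $\Lambda_{++}\times(-\mathbb{R}_+^m)$, where $\mathbb{R}_+=[0,\infty)$.
   Context: A homogeneous polynomial $h\in\mathbb{R}[x_1,\dots,x_n]$ of degree $d$ is hyperbolic with respect to $\mathbf{e}\in\mathbb{R}^n$ if $h(\mathbf{e})\neq0$ and for every $\mathbf{x}\in\mathbb{R}^n$ the polynomial $t\mapsto h(t\mathbf{e}-\mathbf{x})$ has only real zeros; writing $h(t\mathbf{e}-\mathbf{x})=h(\mathbf{e})\prod_{j=1}^d(t-\lambda_j(\mathbf{x}))$, the open hyperbolicity cone is $\Lambda_{++}(h,\mathbf{e})=\{\mathbf{x}:\min_j\lambda_j(\mathbf{x})>0\}$ and $\Lambda_+(h,\mathbf{e})=\{\mathbf{x}:\min_j\lambda_j(\mathbf{x})\geq0\}$. For $\mathbf{v}\in\mathbb{R}^n$, $D_{\mathbf{v}}h=\sum_k v_k\,\partial h/\partial x_k$. The mixed hyperbolic polynomial is $h[\mathbf{v}_1,\dots,\mathbf{v}_m]=\prod_{j=1}^m(1-y_jD_{\mathbf{v}_j})\,h(\mathbf{x})$.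 *)

theory Defs
  imports
    Complex_Main
    "HOL-Library.Poly_Mapping"
    "HOL-Computational_Algebra.Polynomial"
    "Jordan_Normal_Form.Matrix"
begin

text \<open>
  Real polynomials in the variables with indices 0, 1, 2, ...: finitely supported maps from
  monomials (exponent maps) to coefficients, with the ring structure of \<^theory>\<open>HOL-Library.Poly_Mapping\<close>.
  Points of real \<open>n\<close>-space are the vectors in \<open>carrier_vec n\<close>, and the \<open>k\<close>-th coordinate
  (counted from 0) belongs to the variable with index \<open>k\<close>.
\<close>

type_synonym rpoly = "(nat \<Rightarrow>\<^sub>0 nat) \<Rightarrow>\<^sub>0 real"

definition polys_in :: "nat \<Rightarrow> rpoly set" where
  "polys_in n = {p. \<forall>m \<in> Poly_Mapping.keys p. Poly_Mapping.keys m \<subseteq> {..<n}}"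

definition mon_degree :: "(nat \<Rightarrow>\<^sub>0 nat) \<Rightarrow> nat" where
  "mon_degree m = (\<Sum>i \<in> Poly_Mapping.keys m. Poly_Mapping.lookup m i)"

definition homogeneous :: "nat \<Rightarrow> rpoly \<Rightarrow> bool" where
  "homogeneous d p \<longleftrightarrow> (\<forall>m \<in> Poly_Mapping.keys p. mon_degree m = d)"

definition rpvar :: "nat \<Rightarrow> rpoly" where
  "rpvar i = Poly_Mapping.single (Poly_Mapping.single i 1) 1"

definition rpconst :: "real \<Rightarrow> rpoly" where
  "rpconst c = Poly_Mapping.single 0 c"

text \<open>Substitution of \<open>f i\<close> for the variable \<open>i\<close>, where \<open>c\<close> embeds the coefficients into the target ring.\<close>

definition rpsubst :: "(real \<Rightarrow> 'b) \<Rightarrow> (nat \<Rightarrow> 'b) \<Rightarrow> rpoly \<Rightarrow> 'b::comm_semiring_1" where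
  "rpsubst c f p = (\<Sum>m \<in> Poly_Mapping.keys p. c (Poly_Mapping.lookup p m) *
     (\<Prod>i \<in> Poly_Mapping.keys m. f i ^ Poly_Mapping.lookup m i))"

definition rpeval :: "rpoly \<Rightarrow> real vec \<Rightarrow> real" where
  "rpeval p x = rpsubst (\<lambda>a. a) (\<lambda>i. x $ i) p"

text \<open>In \<open>rpderiv\<close>, subtraction of exponents truncates, but only where the coefficient vanishes.\<close>

definition rpderiv :: "nat \<Rightarrow> rpoly \<Rightarrow> rpoly" where
  "rpderiv k p = (\<Sum>m \<in> Poly_Mapping.keys p.
     Poly_Mapping.single (m - Poly_Mapping.single k 1)
       (real (Poly_Mapping.lookup m k) * Poly_Mapping.lookup p m))"

definition dir_deriv :: "real vec \<Rightarrow> rpoly \<Rightarrow> rpoly" where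
  "dir_deriv v p = (\<Sum>k<dim_vec v. rpconst (v $ k) * rpderiv k p)"

text \<open>The univariate polynomial \<open>t \<mapsto> h (t e - x)\<close>.\<close>

definition line_poly :: "rpoly \<Rightarrow> real vec \<Rightarrow> real vec \<Rightarrow> real poly" where
  "line_poly h e x = rpsubst (\<lambda>a. [:a:]) (\<lambda>i. [:- (x $ i), e $ i:]) h"

lemma poly_line_poly:
  assumes "h \<in> polys_in n" "e \<in> carrier_vec n" "x \<in> carrier_vec n"
  shows "poly (line_poly h e x) t = rpeval h (t \<cdot>\<^sub>v e - x)"
  unfolding line_poly_def rpeval_def rpsubst_def poly_sum poly_mult poly_prod poly_power
proof (intro sum.cong refl arg_cong2[where f = "(*)"] prod.cong)
  fix m i assume "m \<in> Poly_Mapping.keys h" "i \<in> Poly_Mapping.keys m"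
  then have "i < n" using assms(1) by (auto simp: polys_in_def)
  then show "poly [:- (x $ i), e $ i:] t ^ Poly_Mapping.lookup m i
      = (t \<cdot>\<^sub>v e - x) $ i ^ Poly_Mapping.lookup m i"
    using assms by simp
qed simp

definition hyperbolic :: "nat \<Rightarrow> rpoly \<Rightarrow> real vec \<Rightarrow> bool" where
  "hyperbolic n h e \<longleftrightarrow>
     h \<in> polys_in n \<and> (\<exists>d. homogeneous d h) \<and> e \<in> carrier_vec n \<and> rpeval h e \<noteq> 0 \<and>
     (\<forall>x \<in> carrier_vec n. \<forall>z::complex.
        poly (map_poly complex_of_real (line_poly h e x)) z = 0 \<longrightarrow> z \<in> \<real>)"

text \<open>
  The multiset of the \<open>\<lambda>\<^sub>j(x)\<close>. A bound on their minimum is expressed as a bound on each of them,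
  so that for constant \<open>h\<close>, where there are none, both cones are the whole space.
\<close>

definition hyp_eigenvalues :: "rpoly \<Rightarrow> real vec \<Rightarrow> real vec \<Rightarrow> real multiset" where
  "hyp_eigenvalues h e x = proots (line_poly h e x)"

definition open_hyp_cone :: "nat \<Rightarrow> rpoly \<Rightarrow> real vec \<Rightarrow> real vec set" where
  "open_hyp_cone n h e = {x \<in> carrier_vec n. \<forall>l \<in># hyp_eigenvalues h e x. l > 0}"

definition closed_hyp_cone :: "nat \<Rightarrow> rpoly \<Rightarrow> real vec \<Rightarrow> real vec set" where
  "closed_hyp_cone n h e = {x \<in> carrier_vec n. \<forall>l \<in># hyp_eigenvalues h e x. l \<ge> 0}"

text \<open>
  For \<open>h\<close> in the variables \<open>x\<^sub>1, ..., x\<^sub>n\<close> (indices \<open>0, ..., n - 1\<close>), the variables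
  \<open>y\<^sub>1, ..., y\<^sub>m\<close> get the indices \<open>n, ..., n + m - 1\<close>, and the vectors are \<open>v 0, ..., v (m - 1)\<close>.
  For \<open>v j\<close> in \<open>carrier_vec n\<close> the operator \<open>dir_deriv (v j)\<close> differentiates in the \<open>x\<close>-variables only.
\<close>

definition mixed_hyp_poly :: "nat \<Rightarrow> nat \<Rightarrow> (nat \<Rightarrow> real vec) \<Rightarrow> rpoly \<Rightarrow> rpoly" where
  "mixed_hyp_poly n m v h =
     foldr (\<lambda>j g. g - rpvar (n + j) * dir_deriv (v j) g) [0..<m] h"

end

theory Submission
  imports Defs "HOL-Analysis.Elementary_Topology" "HOL-Computational_Algebra.Fundamental_Theorem_Algebra"
begin

text \<open>
  Call \<open>w\<close> tubular if \<open>h (x + i (w + \<alpha> e)) \<noteq> 0\<close> for all real \<open>x\<close> and all \<open>\<alpha> > 0\<close>. Hyperbolicity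
  makes \<open>0\<close> tubular, and a homotopy argument for the zeros of \<open>r \<mapsto> h (z + r b)\<close> shows that
  tubularity survives adding nonnegative multiples of elements \<open>b\<close> of the closed hyperbolicity cone.
  If \<open>g\<close> does not vanish on the tube of points \<open>x + i (w + \<alpha> e)\<close> with \<open>w\<close> tubular, then
  \<open>q (s) = g (z + s v\<^sub>j)\<close> has all its zeros in the open lower half-plane, so either \<open>q\<close> is
  constant or \<open>Im (q'/q) < 0\<close> at \<open>0\<close>. In both cases \<open>q - y q' \<noteq> 0\<close> at \<open>0\<close> whenever
  \<open>Im y \<le> 0\<close>. By induction the mixed polynomial does not vanish at \<open>(z, y)\<close> for \<open>z\<close> in the tube and
  \<open>Im y\<^sub>j \<le> 0\<close>. Real \<open>y\<close> give hyperbolicity; purely imaginary \<open>z\<close> and \<open>y\<close>, together with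
  homogeneity, give the cone.
\<close>

subsection \<open>Substitution and evaluation\<close>

definition monom_eval :: "(nat \<Rightarrow> 'b) \<Rightarrow> (nat \<Rightarrow>\<^sub>0 nat) \<Rightarrow> 'b::comm_semiring_1" where
  "monom_eval z m = (\<Prod>i \<in> Poly_Mapping.keys m. z i ^ Poly_Mapping.lookup m i)"

lemma rpsubst_alt:
  "rpsubst c f p = (\<Sum>m \<in> Poly_Mapping.keys p. c (Poly_Mapping.lookup p m) * monom_eval f m)"
  by (simp add: rpsubst_def monom_eval_def)

lemma monom_eval_superset:
  assumes "finite A" "Poly_Mapping.keys m \<subseteq> A"
  shows "monom_eval z m = (\<Prod>i \<in> A. z i ^ Poly_Mapping.lookup m i)"
  unfolding monom_eval_def using assms
  by (intro prod.mono_neutral_left) (auto simp: in_keys_iff)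

lemma monom_eval_add: "monom_eval z (m + m') = monom_eval z m * monom_eval z m'"
proof -
  let ?A = "Poly_Mapping.keys m \<union> Poly_Mapping.keys m'"
  have "Poly_Mapping.keys (m + m') \<subseteq> ?A" by (rule keys_add)
  then show ?thesis
    by (simp add: monom_eval_superset[of ?A] lookup_add power_add prod.distrib)
qed

lemma monom_eval_zero [simp]: "monom_eval z 0 = 1"
  by (simp add: monom_eval_def)

lemma monom_eval_single [simp]: "monom_eval z (Poly_Mapping.single i (Suc 0)) = z i"
  by (simp add: monom_eval_def)

lemma monom_eval_scale: "monom_eval (\<lambda>i. c * z i) m = c ^ mon_degree m * monom_eval z m"
  by (simp add: monom_eval_def mon_degree_def power_mult_distrib prod.distrib power_sum)

lemma mon_degree_superset:
  assumes "finite A" "Poly_Mapping.keys m \<subseteq> A"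
  shows "mon_degree m = (\<Sum>i \<in> A. Poly_Mapping.lookup m i)"
  unfolding mon_degree_def using assms
  by (intro sum.mono_neutral_left) (auto simp: in_keys_iff)

lemma mon_degree_add: "mon_degree (m + m') = mon_degree m + mon_degree m'"
proof -
  let ?A = "Poly_Mapping.keys m \<union> Poly_Mapping.keys m'"
  have "Poly_Mapping.keys (m + m') \<subseteq> ?A" by (rule keys_add)
  then show ?thesis
    by (simp add: mon_degree_superset[of ?A] lookup_add sum.distrib)
qed

lemma mon_degree_single [simp]: "mon_degree (Poly_Mapping.single i (Suc 0)) = 1"
  by (simp add: mon_degree_def)

lemma single_add_diff:
  assumes "Poly_Mapping.lookup m k > 0"
  shows "Poly_Mapping.single k 1 + (m - Poly_Mapping.single k 1) = (m :: nat \<Rightarrow>\<^sub>0 nat)"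
  using assms by (intro poly_mapping_eqI) (auto simp: lookup_add lookup_minus lookup_single when_def)

text \<open>A substitution is built from finite sums, products and powers, so any map respecting
  these passes through it. The instances are evaluation at a point, the embedding of the reals and
  complex conjugation.\<close>

lemma rpsubst_hom:
  assumes "\<phi> 0 = 0" "\<phi> 1 = 1" "\<And>a b. \<phi> (a + b) = \<phi> a + \<phi> b" "\<And>a b. \<phi> (a * b) = \<phi> a * \<phi> b"
  shows "\<phi> (rpsubst c f p) = rpsubst (\<lambda>a. \<phi> (c a)) (\<lambda>i. \<phi> (f i)) p"
proof -
  have pow: "\<phi> (a ^ k) = \<phi> a ^ k" for a k by (induction k) (auto simp: assms)
  have prd: "\<phi> (prod g A) = (\<Prod>i\<in>A. \<phi> (g i))" for g and A :: "nat set"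
    by (induction A rule: infinite_finite_induct) (auto simp: assms)
  have sm: "\<phi> (sum g A) = (\<Sum>i\<in>A. \<phi> (g i))" for g and A :: "(nat \<Rightarrow>\<^sub>0 nat) set"
    by (induction A rule: infinite_finite_induct) (auto simp: assms)
  show ?thesis by (simp add: rpsubst_def sm prd pow assms)
qed

lemma rpsubst_cong:
  assumes "p \<in> polys_in n" "\<And>i. i < n \<Longrightarrow> f i = g i"
  shows "rpsubst c f p = rpsubst c g p"
  unfolding rpsubst_def
proof (intro sum.cong refl arg_cong2[where f = "(*)"] prod.cong)
  fix m i assume "m \<in> Poly_Mapping.keys p" "i \<in> Poly_Mapping.keys m"
  then have "i < n" using assms(1) by (auto simp: polys_in_def)
  then show "f i ^ Poly_Mapping.lookup m i = g i ^ Poly_Mapping.lookup m i"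
    using assms(2) by simp
qed

lemma rpsubst_scale:
  assumes "homogeneous d p"
  shows "rpsubst c (\<lambda>i. t * f i) p = t ^ d * rpsubst c f p"
  unfolding rpsubst_alt sum_distrib_left
  using assms by (intro sum.cong) (auto simp: monom_eval_scale homogeneous_def mult_ac)

section \<open>Degree bounds and top coefficients\<close>

lemma coeff_mult_degree_bound:
  assumes "degree p \<le> a" "degree q \<le> b"
  shows "coeff (p * q) (a + b) = coeff p a * coeff q b"
proof (cases "degree p = a \<and> degree q = b")
  case True
  then show ?thesis using coeff_mult_degree_sum[of p q] by auto
next
  case False
  then have "degree p < a \<or> degree q < b" using assms by auto
  moreover have "degree (p * q) < a + b"
    using degree_mult_le[of p q] assms False by linarith
  ultimately show ?thesis by (auto simp: coeff_eq_0)
qed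

lemma degree_coeff_power:
  fixes p :: "'a::comm_semiring_1 poly"
  assumes "degree p \<le> a"
  shows "degree (p ^ k) \<le> a * k \<and> coeff (p ^ k) (a * k) = coeff p a ^ k"
proof (induction k)
  case (Suc k)
  then have "coeff (p * p ^ k) (a + a * k) = coeff p a * coeff p a ^ k"
    using coeff_mult_degree_bound[OF assms] by metis
  moreover have "degree (p * p ^ k) \<le> a + a * k"
    using degree_mult_le[of p "p ^ k"] Suc assms by linarith
  ultimately show ?case by simp
qed simp

lemma degree_coeff_prod:
  fixes p :: "'i \<Rightarrow> 'a::comm_semiring_1 poly"
  assumes "finite A" "\<And>i. i \<in> A \<Longrightarrow> degree (p i) \<le> a i"
  shows "degree (\<Prod>i\<in>A. p i) \<le> (\<Sum>i\<in>A. a i) \<and>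
    coeff (\<Prod>i\<in>A. p i) (\<Sum>i\<in>A. a i) = (\<Prod>i\<in>A. coeff (p i) (a i))"
  using assms
proof (induction A rule: finite_induct)
  case (insert i A)
  let ?P = "\<Prod>i\<in>A. p i" and ?a = "\<Sum>i\<in>A. a i"
  have IH: "degree ?P \<le> ?a" "coeff ?P ?a = (\<Prod>i\<in>A. coeff (p i) (a i))" "degree (p i) \<le> a i"
    using insert by auto
  have "coeff (p i * ?P) (a i + ?a) = coeff (p i) (a i) * coeff ?P ?a"
    by (rule coeff_mult_degree_bound) (use IH in auto)
  moreover have "degree (p i * ?P) \<le> a i + ?a"
    using degree_mult_le[of "p i" ?P] IH by linarith
  ultimately show ?case using insert IH by simp
qed simp

text \<open>Each monomial of \<open>p\<close> becomes a product of \<open>d\<close> linear factors,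
  whose coefficient at \<open>d\<close> is the product of their slopes. The coefficient at
  \<open>d\<close> replaces the leading coefficient because \<open>p\<close> may vanish at
  \<open>b\<close>. That it does not depend on \<open>z\<close> is what later keeps zeros from
  escaping to infinity.\<close>

lemma rpsubst_line:
  fixes c :: "real \<Rightarrow> 'a::comm_semiring_1" and z b :: "nat \<Rightarrow> 'a"
  assumes "homogeneous d p"
  defines "P \<equiv> rpsubst (\<lambda>a. [:c a:]) (\<lambda>i. [:z i, b i:]) p"
  shows "degree P \<le> d" "coeff P d = rpsubst c b p"
proof -
  have lin: "degree [:z i, b i:] \<le> 1" for i by simp
  have 1: "degree (monom_eval (\<lambda>i. [:z i, b i:]) m) \<le> mon_degree m \<and>
    coeff (monom_eval (\<lambda>i. [:z i, b i:]) m) (mon_degree m) = monom_eval b m" for m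
    unfolding monom_eval_def mon_degree_def
    using degree_coeff_prod[of "Poly_Mapping.keys m" "\<lambda>i. [:z i, b i:] ^ Poly_Mapping.lookup m i" "Poly_Mapping.lookup m"]
      degree_coeff_power[OF lin] by simp
  have 2: "degree (Polynomial.smult (c (Poly_Mapping.lookup p m)) (monom_eval (\<lambda>i. [:z i, b i:]) m)) \<le> d"
    "coeff (monom_eval (\<lambda>i. [:z i, b i:]) m) d = monom_eval b m"
    if "m \<in> Poly_Mapping.keys p" for m
    using 1[of m] that assms(1) degree_smult_le[of "c (Poly_Mapping.lookup p m)" "monom_eval (\<lambda>i. [:z i, b i:]) m"]
    by (auto simp: homogeneous_def intro: order.trans)
  show "degree P \<le> d" unfolding P_def rpsubst_alt
    by (rule degree_sum_le) (use 2 in auto)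
  show "coeff P d = rpsubst c b p" unfolding P_def rpsubst_alt
    by (auto simp: coeff_sum 2 intro!: sum.cong)
qed

lemma poly_rpsubst_line:
  fixes c :: "real \<Rightarrow> 'a::comm_semiring_1"
  shows "poly (rpsubst (\<lambda>a. [:c a:]) (\<lambda>i. [:z i, b i:]) p) t = rpsubst c (\<lambda>i. z i + t * b i) p"
  by (subst rpsubst_hom[where \<phi> = "\<lambda>q. poly q t"]) auto

text \<open>Points are functions on all indices, so that they can be scaled and added pointwise
  without dimension conditions; \<open>ceval_cong\<close> discards the values beyond the variables
  that occur.\<close>

definition ceval :: "rpoly \<Rightarrow> (nat \<Rightarrow> complex) \<Rightarrow> complex" where
  "ceval p z = rpsubst complex_of_real z p"

lemma ceval_superset:
  assumes "finite A" "Poly_Mapping.keys p \<subseteq> A"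
  shows "ceval p z = (\<Sum>m \<in> A. of_real (Poly_Mapping.lookup p m) * monom_eval z m)"
  unfolding ceval_def rpsubst_alt using assms
  by (intro sum.mono_neutral_left) (auto simp: in_keys_iff)

lemma ceval_zero [simp]: "ceval 0 z = 0"
  by (simp add: ceval_def rpsubst_def)

lemma ceval_add: "ceval (p + q) z = ceval p z + ceval q z"
proof -
  let ?A = "Poly_Mapping.keys p \<union> Poly_Mapping.keys q"
  have "Poly_Mapping.keys (p + q) \<subseteq> ?A" by (rule keys_add)
  then show ?thesis
    by (simp add: ceval_superset[of ?A] lookup_add sum.distrib distrib_right)
qed

lemma ceval_diff: "ceval (p - q) z = ceval p z - ceval q z"
  using ceval_add[of "p - q" q z] by simp

lemma ceval_sum: "ceval (\<Sum>i\<in>A. f i) z = (\<Sum>i\<in>A. ceval (f i) z)"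
  by (induction A rule: infinite_finite_induct) (auto simp: ceval_add)

lemma ceval_single: "ceval (Poly_Mapping.single m a) z = of_real a * monom_eval z m"
  by (simp add: ceval_def rpsubst_alt)

lemma rpoly_expand:
  "(p :: rpoly) = (\<Sum>m \<in> Poly_Mapping.keys p. Poly_Mapping.single m (Poly_Mapping.lookup p m))"
proof (rule poly_mapping_eqI)
  fix k
  show "Poly_Mapping.lookup p k = Poly_Mapping.lookup (\<Sum>m \<in> Poly_Mapping.keys p. Poly_Mapping.single m (Poly_Mapping.lookup p m)) k"
    by (auto simp: lookup_sum lookup_single when_def in_keys_iff)
qed

text \<open>In the mixed polynomial every left factor is a variable or a constant, hence a single
  term.\<close>

lemma ceval_single_mult:
  "ceval (Poly_Mapping.single m a * p) z = of_real a * monom_eval z m * ceval p z"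
proof -
  have "Poly_Mapping.single m a * p = (\<Sum>k \<in> Poly_Mapping.keys p. Poly_Mapping.single (m + k) (a * Poly_Mapping.lookup p k))"
    by (subst rpoly_expand[of p]) (simp add: sum_distrib_left mult_single)
  then show ?thesis
    by (simp add: ceval_sum ceval_single monom_eval_add) (simp add: ceval_def rpsubst_alt sum_distrib_left mult_ac)
qed

lemma ceval_rpvar_mult: "ceval (rpvar i * p) z = z i * ceval p z"
  by (simp add: rpvar_def ceval_single_mult)

lemma ceval_rpconst_mult: "ceval (rpconst a * p) z = of_real a * ceval p z"
  by (simp add: rpconst_def ceval_single_mult)

lemma ceval_scale: "homogeneous d p \<Longrightarrow> ceval p (\<lambda>i. t * z i) = t ^ d * ceval p z"
  by (simp add: ceval_def rpsubst_scale)

lemma ceval_cong: "p \<in> polys_in n \<Longrightarrow> (\<And>i. i < n \<Longrightarrow> z i = w i) \<Longrightarrow> ceval p z = ceval p w"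
  unfolding ceval_def by (rule rpsubst_cong)

lemma ceval_of_real: "ceval p (\<lambda>i. of_real (x i)) = of_real (rpsubst (\<lambda>a. a) x p)"
  by (simp add: ceval_def rpsubst_hom[where \<phi> = complex_of_real])

lemma ceval_cnj: "ceval p (\<lambda>i. cnj (z i)) = cnj (ceval p z)"
  by (simp add: ceval_def rpsubst_hom[where \<phi> = cnj])

lemma continuous_on_ceval [continuous_intros]:
  assumes "\<And>i. continuous_on A (\<lambda>x. f x i)"
  shows "continuous_on A (\<lambda>x. ceval p (f x))"
  unfolding ceval_def rpsubst_def by (intro continuous_intros assms)

section \<open>Restriction to complex lines and directional derivatives\<close>

definition cline :: "rpoly \<Rightarrow> (nat \<Rightarrow> complex) \<Rightarrow> (nat \<Rightarrow> complex) \<Rightarrow> complex poly" where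
  "cline p z b = rpsubst (\<lambda>a. [:complex_of_real a:]) (\<lambda>i. [:z i, b i:]) p"

lemma poly_cline: "poly (cline p z b) t = ceval p (\<lambda>i. z i + t * b i)"
  by (simp add: cline_def ceval_def poly_rpsubst_line)

lemma monom_eval_line_deriv:
  fixes z b :: "nat \<Rightarrow> complex"
  shows "((\<lambda>s. monom_eval (\<lambda>i. z i + s * b i) m) has_field_derivative
    (\<Sum>k\<in>Poly_Mapping.keys m. b k * (of_nat (Poly_Mapping.lookup m k) * monom_eval z (m - Poly_Mapping.single k 1)))) (at 0)"
proof -
  let ?K = "Poly_Mapping.keys m" and ?L = "Poly_Mapping.lookup m"
  have "((\<lambda>s. \<Prod>i\<in>?K. (z i + s * b i) ^ ?L i) has_field_derivative
     (\<Sum>k\<in>?K. (of_nat (?L k) * (b k * z k ^ (?L k - Suc 0))) * (\<Prod>i\<in>?K - {k}. (z i + 0 * b i) ^ ?L i))) (at 0)"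
    by (rule has_field_derivative_prod) (auto intro!: derivative_eq_intros)
  also have "(\<Sum>k\<in>?K. (of_nat (?L k) * (b k * z k ^ (?L k - Suc 0))) * (\<Prod>i\<in>?K - {k}. (z i + 0 * b i) ^ ?L i))
    = (\<Sum>k\<in>?K. b k * (of_nat (?L k) * monom_eval z (m - Poly_Mapping.single k 1)))"
  proof (intro sum.cong refl)
    fix k assume k: "k \<in> ?K"
    have "Poly_Mapping.keys (m - Poly_Mapping.single k 1) \<subseteq> ?K"
      by (auto simp: in_keys_iff lookup_minus)
    then have "monom_eval z (m - Poly_Mapping.single k 1)
      = (\<Prod>i\<in>?K. z i ^ Poly_Mapping.lookup (m - Poly_Mapping.single k 1) i)"
      by (intro monom_eval_superset) auto
    also have "\<dots> = z k ^ (?L k - 1) * (\<Prod>i\<in>?K - {k}. z i ^ ?L i)"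
      using k by (subst prod.remove[of _ k]) (auto simp: lookup_minus lookup_single when_def intro!: prod.cong)
    finally show "(of_nat (?L k) * (b k * z k ^ (?L k - Suc 0))) * (\<Prod>i\<in>?K - {k}. (z i + 0 * b i) ^ ?L i)
      = b k * (of_nat (?L k) * monom_eval z (m - Poly_Mapping.single k 1))"
      by (simp add: mult_ac)
  qed
  finally show ?thesis by (simp add: monom_eval_def)
qed

lemma ceval_rpderiv:
  "ceval (rpderiv k p) z = (\<Sum>m\<in>Poly_Mapping.keys p. of_real (Poly_Mapping.lookup p m) *
     (of_nat (Poly_Mapping.lookup m k) * monom_eval z (m - Poly_Mapping.single k 1)))"
  by (simp add: rpderiv_def ceval_sum ceval_single mult_ac)

text \<open>Both sides are the derivative of \<open>p (z + s v)\<close> at \<open>s = 0\<close>,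
  which is unique. The direction is cut off at \<open>n\<close> because entries of \<open>v\<close>
  beyond its dimension are unspecified, and because the variables from \<open>n\<close> on, later
  the y-variables, have to stay fixed.\<close>

lemma poly_pderiv_cline:
  assumes "v \<in> carrier_vec n"
  shows "poly (pderiv (cline p z (\<lambda>i. if i < n then of_real (v $ i) else 0))) 0 = ceval (dir_deriv v p) z"
proof -
  define b where "b = (\<lambda>i. if i < n then complex_of_real (v $ i) else 0)"
  let ?D = "\<lambda>m k. of_nat (Poly_Mapping.lookup m k) * monom_eval z (m - Poly_Mapping.single k 1)"
  have "((\<lambda>s. ceval p (\<lambda>i. z i + s * b i)) has_field_derivative
     (\<Sum>m\<in>Poly_Mapping.keys p. of_real (Poly_Mapping.lookup p m) * (\<Sum>k\<in>Poly_Mapping.keys m. b k * ?D m k))) (at 0)"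
    unfolding ceval_def rpsubst_alt
    by (intro DERIV_sum DERIV_cmult monom_eval_line_deriv)
  also have "(\<Sum>m\<in>Poly_Mapping.keys p. of_real (Poly_Mapping.lookup p m) * (\<Sum>k\<in>Poly_Mapping.keys m. b k * ?D m k))
     = (\<Sum>m\<in>Poly_Mapping.keys p. of_real (Poly_Mapping.lookup p m) * (\<Sum>k<n. of_real (v $ k) * ?D m k))"
  proof (rule sum.cong[OF refl], rule arg_cong2[where f = "(*)", OF refl])
    fix m
    \<comment> \<open>Indices in only one of the two ranges contribute zero: \<open>b\<close>
      vanishes from \<open>n\<close> on, and the exponent vanishes off the keys of
      \<open>m\<close>.\<close>
    show "(\<Sum>k\<in>Poly_Mapping.keys m. b k * ?D m k) = (\<Sum>k<n. of_real (v $ k) * ?D m k)"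
      by (rule sum.mono_neutral_cong) (auto simp: b_def in_keys_iff)
  qed
  also have "\<dots> = ceval (dir_deriv v p) z"
    using assms unfolding dir_deriv_def
    by (simp add: ceval_sum ceval_rpconst_mult ceval_rpderiv sum_distrib_left mult.left_commute)
       (rule sum.swap)
  finally have "(poly (cline p z b) has_field_derivative ceval (dir_deriv v p) z) (at 0)"
    by (simp add: poly_cline[abs_def])
  then show ?thesis
    unfolding b_def using DERIV_unique poly_DERIV by blast
qed

section \<open>Homogeneity and variables of the mixed polynomial\<close>

lemma homogeneous_add: "homogeneous d p \<Longrightarrow> homogeneous d q \<Longrightarrow> homogeneous d (p + q)"
  using keys_add[of p q] by (auto simp: homogeneous_def)

lemma homogeneous_diff: "homogeneous d p \<Longrightarrow> homogeneous d q \<Longrightarrow> homogeneous d (p - q)"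
  using keys_diff[of p q] by (auto simp: homogeneous_def)

lemma homogeneous_sum: "(\<And>i. i \<in> A \<Longrightarrow> homogeneous d (f i)) \<Longrightarrow> homogeneous d (\<Sum>i\<in>A. f i)"
  by (induction A rule: infinite_finite_induct) (auto simp: homogeneous_add, auto simp: homogeneous_def)

lemma polys_in_add: "p \<in> polys_in n \<Longrightarrow> q \<in> polys_in n \<Longrightarrow> p + q \<in> polys_in n"
  using keys_add[of p q] by (fastforce simp: polys_in_def)

lemma polys_in_diff: "p \<in> polys_in n \<Longrightarrow> q \<in> polys_in n \<Longrightarrow> p - q \<in> polys_in n"
  using keys_diff[of p q] by (fastforce simp: polys_in_def)

lemma polys_in_sum: "(\<And>i. i \<in> A \<Longrightarrow> f i \<in> polys_in n) \<Longrightarrow> (\<Sum>i\<in>A. f i) \<in> polys_in n"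
  by (induction A rule: infinite_finite_induct) (auto simp: polys_in_add, auto simp: polys_in_def)

lemma polys_in_mono: "p \<in> polys_in n \<Longrightarrow> n \<le> n' \<Longrightarrow> p \<in> polys_in n'"
  by (fastforce simp: polys_in_def)

text \<open>Expanding into single terms allows degree and variables to be checked term by term: the
  factor \<open>rpvar i\<close> restores the degree that differentiation takes away.\<close>

lemma rpvar_mult_dir_deriv:
  "rpvar i * dir_deriv v p = (\<Sum>k<dim_vec v. \<Sum>m\<in>Poly_Mapping.keys p.
     Poly_Mapping.single (Poly_Mapping.single i 1 + (m - Poly_Mapping.single k 1))
       (v $ k * (real (Poly_Mapping.lookup m k) * Poly_Mapping.lookup p m)))"
  by (simp add: dir_deriv_def rpvar_def rpconst_def rpderiv_def sum_distrib_left mult_single)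

lemma homogeneous_rpvar_dir_deriv:
  assumes "homogeneous d p"
  shows "homogeneous d (rpvar i * dir_deriv v p)"
  unfolding rpvar_mult_dir_deriv
proof (intro homogeneous_sum)
  fix k m assume m: "m \<in> Poly_Mapping.keys p"
  show "homogeneous d (Poly_Mapping.single (Poly_Mapping.single i 1 + (m - Poly_Mapping.single k 1))
       (v $ k * (real (Poly_Mapping.lookup m k) * Poly_Mapping.lookup p m)))"
  \<comment> \<open>If the variable \<open>k\<close> is absent from \<open>m\<close>, the truncated
    exponent has the wrong degree, but the coefficient is zero and the term disappears.\<close>
  proof (cases "Poly_Mapping.lookup m k = 0")
    case False
    then have "mon_degree m = mon_degree (Poly_Mapping.single k 1) + mon_degree (m - Poly_Mapping.single k 1)"
      by (metis single_add_diff mon_degree_add neq0_conv)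
    then show ?thesis using assms m by (auto simp: homogeneous_def mon_degree_add)
  qed (simp add: homogeneous_def)
qed

lemma polys_in_rpvar_dir_deriv:
  assumes "p \<in> polys_in n" "i < n"
  shows "rpvar i * dir_deriv v p \<in> polys_in n"
  unfolding rpvar_mult_dir_deriv
proof (intro polys_in_sum)
  fix k m assume m: "m \<in> Poly_Mapping.keys p"
  have "Poly_Mapping.keys (m - Poly_Mapping.single k 1) \<subseteq> Poly_Mapping.keys m"
    by (auto simp: in_keys_iff lookup_minus)
  then have "Poly_Mapping.keys (Poly_Mapping.single i 1 + (m - Poly_Mapping.single k 1)) \<subseteq> insert i (Poly_Mapping.keys m)"
    using keys_add[of "Poly_Mapping.single i 1" "m - Poly_Mapping.single k 1"] by auto
  then show "Poly_Mapping.single (Poly_Mapping.single i 1 + (m - Poly_Mapping.single k 1))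
       (v $ k * (real (Poly_Mapping.lookup m k) * Poly_Mapping.lookup p m)) \<in> polys_in n"
    using assms m by (auto simp: polys_in_def)
qed

section \<open>Complex zeros of the line polynomial\<close>

lemma map_poly_of_real_add:
  "map_poly complex_of_real (p + q) = map_poly of_real p + map_poly of_real q"
  by (rule poly_eqI) (simp add: coeff_map_poly)

lemma poly_map_poly_of_real_mult:
  "poly (map_poly complex_of_real (p * q)) z = poly (map_poly of_real p) z * poly (map_poly of_real q) z"
proof -
  have smult: "map_poly complex_of_real (Polynomial.smult a b) = Polynomial.smult (of_real a) (map_poly of_real b)" for a b
    by (rule poly_eqI) (simp add: coeff_map_poly)
  show ?thesis
    by (induction p) (auto simp: map_poly_of_real_add smult map_poly_pCons algebra_simps)
qed

lemma poly_map_line_poly: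
  "poly (map_poly complex_of_real (line_poly h e x)) z = ceval h (\<lambda>i. z * of_real (e $ i) - of_real (x $ i))"
proof -
  have "poly (map_poly complex_of_real (line_poly h e x)) z
     = rpsubst (\<lambda>a. poly (map_poly complex_of_real [:a:]) z)
        (\<lambda>i. poly (map_poly complex_of_real [:- (x $ i), e $ i:]) z) h"
    unfolding line_poly_def
    by (rule rpsubst_hom[where \<phi> = "\<lambda>q. poly (map_poly complex_of_real q) z"])
       (auto simp: map_poly_of_real_add poly_map_poly_of_real_mult)
  also have "\<dots> = ceval h (\<lambda>i. z * of_real (e $ i) - of_real (x $ i))"
    by (simp add: ceval_def map_poly_pCons)
  finally show ?thesis .
qed

subsection \<open>Zeros in half-planes\<close>

text \<open>Split off one root \<open>r\<close> at a time. For \<open>Im s \<ge> 0\<close> the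
  factor satisfies \<open>norm (s - r) \<ge> Im s\<close>, and it adds \<open>- 1 / r\<close>, of
  negative imaginary part, to the logarithmic derivative at 0. The lower bound serves the homotopy
  argument, the logarithmic derivative the operators \<open>1 - y D\<close>.\<close>

lemma lower_half_plane_roots:
  fixes P :: "complex poly"
  assumes "P \<noteq> 0" "\<And>r. poly P r = 0 \<Longrightarrow> Im r < 0"
  shows "(\<forall>s. Im s \<ge> 0 \<longrightarrow> norm (lead_coeff P) * Im s ^ degree P \<le> norm (poly P s)) \<and>
    (degree P = 0 \<or> Im (poly (pderiv P) 0 / poly P 0) < 0)"
  using assms
proof (induction "degree P" arbitrary: P)
  case 0
  then obtain a where "P = [:a:]" by (metis degree_eq_zeroE)
  then show ?case by simp
next
  case (Suc k)
  then have "\<not> constant (poly P)" by (simp add: constant_degree)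
  then obtain r where r: "poly P r = 0" using fundamental_theorem_of_algebra by blast
  then obtain Q where P: "P = [:- r, 1:] * Q" by (auto simp: poly_eq_0_iff_dvd dvd_def)
  have Q0: "Q \<noteq> 0" using P Suc.prems by auto
  have "degree P = 1 + degree Q" unfolding P using Q0 by (subst degree_mult_eq) auto
  then have k: "k = degree Q" using Suc.hyps by simp
  have Qr: "Im s < 0" if "poly Q s = 0" for s using that Suc.prems P by auto
  have IH: "norm (lead_coeff Q) * Im s ^ degree Q \<le> norm (poly Q s)" if "Im s \<ge> 0" for s
    using Suc.hyps(1)[OF k Q0 Qr] that by auto
  have IH2: "degree Q = 0 \<or> Im (poly (pderiv Q) 0 / poly Q 0) < 0"
    using Suc.hyps(1)[OF k Q0 Qr] by auto
  have rneg: "Im r < 0" using r Suc.prems by auto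
  have lc: "lead_coeff P = lead_coeff Q" unfolding P by (subst lead_coeff_mult) simp
  have "norm (lead_coeff P) * Im s ^ degree P \<le> norm (poly P s)" if s: "Im s \<ge> 0" for s
  proof -
    have "Im s \<le> Im (s - r)" using rneg by simp
    also have "\<dots> \<le> norm (s - r)" using abs_Im_le_cmod[of "s - r"] by linarith
    finally have "Im s * (norm (lead_coeff Q) * Im s ^ degree Q) \<le> norm (s - r) * norm (poly Q s)"
      using IH[OF s] s by (intro mult_mono) auto
    also have "norm (s - r) * norm (poly Q s) = norm (poly P s)"
      unfolding P by (simp add: norm_mult[symmetric] algebra_simps)
    finally show ?thesis using lc \<open>degree P = 1 + degree Q\<close> by (simp add: mult_ac)
  qed
  moreover have "Im (poly (pderiv P) 0 / poly P 0) < 0"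
  proof -
    have r0: "r \<noteq> 0" using rneg by auto
    have q0: "poly Q 0 \<noteq> 0" using Qr[of 0] by auto
    have dP: "pderiv P = [:- r, 1:] * pderiv Q + Q"
      by (simp only: P pderiv_mult) (simp add: pderiv_pCons)
    have "poly (pderiv P) 0 / poly P 0 = - (1 / r) + poly (pderiv Q) 0 / poly Q 0"
      unfolding dP unfolding P using r0 q0 by (simp add: field_simps)
    moreover have "Im (- (1 / r)) < 0"
      using rneg r0 by (simp add: Im_divide' divide_neg_pos)
    moreover have "Im (poly (pderiv Q) 0 / poly Q 0) \<le> 0"
    proof (cases "degree Q = 0")
      case True
      then obtain a where "Q = [:a:]" by (metis degree_eq_zeroE)
      then show ?thesis by simp
    qed (use IH2 in auto)
    ultimately show ?thesis by simp
  qed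
  ultimately show ?case by blast
qed

text \<open>If the difference vanished, \<open>y\<close> would be the inverse of the logarithmic
  derivative \<open>a\<close> at 0. Inversion sends the open lower half-plane to the open upper one,
  contrary to \<open>Im y \<le> 0\<close>.\<close>

lemma minus_pderiv_nonzero:
  fixes P :: "complex poly"
  assumes "\<And>r. Im r \<ge> 0 \<Longrightarrow> poly P r \<noteq> 0" "Im y \<le> 0"
  shows "poly P 0 - y * poly (pderiv P) 0 \<noteq> 0"
proof
  assume eq: "poly P 0 - y * poly (pderiv P) 0 = 0"
  have P0: "poly P 0 \<noteq> 0" using assms(1)[of 0] by simp
  then have "P \<noteq> 0" by auto
  then have "degree P = 0 \<or> Im (poly (pderiv P) 0 / poly P 0) < 0"
    using lower_half_plane_roots[of P] assms(1) by (meson not_le)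
  \<comment> \<open>For constant \<open>P\<close> the derivative is zero and the assumed equation
    would give \<open>poly P 0 = 0\<close>.\<close>
  moreover have "degree P \<noteq> 0"
    using eq P0 by (metis degree_eq_zeroE diff_zero mult_zero_right pderiv_eq_0_iff poly_0)
  moreover define a where "a = poly (pderiv P) 0 / poly P 0"
  ultimately have a: "Im a < 0" by simp
  have "y * a = 1" using eq P0 by (simp add: a_def field_simps)
  moreover have "a \<noteq> 0" using a by auto
  ultimately have "y = 1 / a" by (simp add: field_simps)
  moreover have "Im (1 / a) > 0" using a \<open>a \<noteq> 0\<close> by (simp add: Im_divide' divide_neg_pos)
  ultimately show False using assms(2) by simp
qed

text \<open>
  Zeros of a polynomial with constant leading coefficient \<open>p b\<close> cannot cross the real axis along a
  homotopy without vanishing there. The set \<open>S\<close> of bad parameters is closed by compactness in the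
  projective coordinates \<open>(u, a + i c)\<close> of the zero \<open>(a + i c) / u\<close>; its complement is closed by the lower bound
  \<open>\<bar>p b\<bar> (Im s)\<^sup>d\<close>.
\<close>

lemma upper_half_plane_homotopy:
  fixes Z :: "real \<Rightarrow> nat \<Rightarrow> complex"
  assumes hom: "homogeneous d p" and b: "ceval p b \<noteq> 0"
    and cont: "\<And>i. continuous_on UNIV (\<lambda>\<theta>. Z \<theta> i)"
    and noreal: "\<And>\<theta> r. \<theta> \<in> {0..1} \<Longrightarrow> ceval p (\<lambda>i. Z \<theta> i + of_real r * b i) \<noteq> 0"
    and start: "\<And>r. Im r \<ge> 0 \<Longrightarrow> ceval p (\<lambda>i. Z 0 i + r * b i) \<noteq> 0"
    and "Im r \<ge> 0"
  shows "ceval p (\<lambda>i. Z 1 i + r * b i) \<noteq> 0"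
proof -
  define F where "F = (\<lambda>\<theta> s. ceval p (\<lambda>i. Z \<theta> i + s * b i))"
  define S where "S = {\<theta> \<in> {0..1}. \<exists>s. Im s \<ge> 0 \<and> F \<theta> s = 0}"
  define G where "G = {\<theta> \<in> {0..1}. \<forall>s. Im s \<ge> 0 \<longrightarrow> norm (ceval p b) * Im s ^ d \<le> norm (F \<theta> s)}"
  define W where "W = ({0..1} \<times> {0..1} \<times> {-1..1} \<times> {0..1}) \<inter>
    {(\<theta>::real, u::real, a::real, c::real). u + \<bar>a\<bar> + c = 1 \<and>
       ceval p (\<lambda>i. of_real u * Z \<theta> i + (of_real a + \<i> * of_real c) * b i) = 0}"
  have [continuous_intros]: "continuous_on A (\<lambda>x. Z (f x) i)" if "continuous_on A f" for A f i
    using continuous_on_compose2[OF cont that] by auto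
  have "closed {x::real \<times> real \<times> real \<times> real. fst (snd x) + \<bar>fst (snd (snd x))\<bar> + snd (snd (snd x)) = 1 \<and>
      ceval p (\<lambda>i. of_real (fst (snd x)) * Z (fst x) i +
        (of_real (fst (snd (snd x))) + \<i> * of_real (snd (snd (snd x)))) * b i) = 0}"
    by (intro closed_Collect_conj closed_Collect_eq continuous_intros)
  then have "compact W" unfolding W_def
    by (intro compact_Int_closed compact_Times compact_Icc) (simp add: case_prod_beta')
  then have "compact (fst ` W)"
    by (intro compact_continuous_image continuous_intros)
  moreover have "fst ` W = S"
  proof (intro equalityI subsetI)
    fix \<theta> assume "\<theta> \<in> fst ` W"
    then obtain u a c where ur: "0 \<le> \<theta>" "\<theta> \<le> 1" "0 \<le> u" "u + \<bar>a\<bar> + c = 1" "0 \<le> c"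
      "ceval p (\<lambda>i. of_real u * Z \<theta> i + (of_real a + \<i> * of_real c) * b i) = 0"
      by (auto simp: W_def)
    define r where "r = of_real a + \<i> * complex_of_real c"
    \<comment> \<open>A solution with \<open>u = 0\<close> would be a zero at infinity; there the
      polynomial reduces to \<open>r ^ d * ceval p b\<close>, which is nonzero.\<close>
    have "u \<noteq> 0"
    proof
      assume "u = 0"
      then have "r ^ d * ceval p b = 0"
        using ur ceval_scale[OF hom, of r b] by (simp add: r_def)
      moreover have "r \<noteq> 0" using ur \<open>u = 0\<close> by (auto simp: r_def complex_eq_iff)
      ultimately show False using b by simp
    qed
    have "ceval p (\<lambda>i. of_real u * (Z \<theta> i + r / of_real u * b i)) = 0"
      using ur \<open>u \<noteq> 0\<close> by (simp add: distrib_left r_def)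
    then have "F \<theta> (r / of_real u) = 0"
      using \<open>u \<noteq> 0\<close> by (simp add: ceval_scale[OF hom] F_def)
    moreover have "Im (r / of_real u) \<ge> 0" using ur by (simp add: r_def)
    ultimately show "\<theta> \<in> S" using ur(1,2) unfolding S_def atLeastAtMost_iff mem_Collect_eq by blast
  next
    fix \<theta> assume "\<theta> \<in> S"
    then obtain s where s: "0 \<le> \<theta>" "\<theta> \<le> 1" "Im s \<ge> 0" "F \<theta> s = 0" by (auto simp: S_def)
    \<comment> \<open>The scaling that puts the projective coordinates \<open>(1, s)\<close> on the
      compact slice \<open>u + \<bar>a\<bar> + c = 1\<close>.\<close>
    define u where "u = 1 / (1 + \<bar>Re s\<bar> + Im s)"
    have "1 + \<bar>Re s\<bar> + Im s > 0" using s by simp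
    then have "0 < u" "u * (1 + \<bar>Re s\<bar> + Im s) = 1" by (auto simp: u_def)
    then have u: "0 < u" "u + u * \<bar>Re s\<bar> + u * Im s = 1" by (simp_all add: distrib_left)
    have "ceval p (\<lambda>i. of_real u * (Z \<theta> i + s * b i)) = 0"
      using s by (simp add: ceval_scale[OF hom] F_def)
    moreover have "of_real u * (Z \<theta> i + s * b i)
        = of_real u * Z \<theta> i + (of_real (u * Re s) + \<i> * of_real (u * Im s)) * b i" for i
      by (simp add: complex_eq_iff algebra_simps)
    ultimately have "ceval p (\<lambda>i. of_real u * Z \<theta> i + (of_real (u * Re s) + \<i> * of_real (u * Im s)) * b i) = 0"
      by (simp only:)
    moreover have "0 \<le> u * Im s" "0 \<le> u * \<bar>Re s\<bar>" using u s by auto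
    moreover from this u have "u \<le> 1" "u * Im s \<le> 1" "u * \<bar>Re s\<bar> \<le> 1" by linarith+
    moreover have "\<bar>u * Re s\<bar> = u * \<bar>Re s\<bar>" using u by (simp add: abs_mult)
    ultimately have "(\<theta>, u, u * Re s, u * Im s) \<in> W"
      using s(1,2) u unfolding W_def by (auto simp: abs_le_iff)
    then show "\<theta> \<in> fst ` W" by force
  qed
  ultimately have "closed S" by (simp add: compact_imp_closed)
  have "closed {\<theta>. norm (ceval p b) * Im s ^ d \<le> norm (F \<theta> s)}" for s
    unfolding F_def by (intro closed_Collect_le continuous_intros)
  then have "closed ({0..1} \<inter> (\<Inter>s\<in>{s. Im s \<ge> 0}. {\<theta>. norm (ceval p b) * Im s ^ d \<le> norm (F \<theta> s)}))"
    by (intro closed_Int closed_INT) auto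
  moreover have "({0..1} \<inter> (\<Inter>s\<in>{s. Im s \<ge> 0}. {\<theta>. norm (ceval p b) * Im s ^ d \<le> norm (F \<theta> s)})) = G"
    by (auto simp: G_def)
  ultimately have "closed G" by simp
  \<comment> \<open>For a parameter in \<open>G\<close> the lower bound excludes zeros with
    \<open>Im s > 0\<close>, so only a real zero could remain, and \<open>noreal\<close> excludes
    that.\<close>
  have "S \<inter> G \<inter> {0..1} = {}"
  proof (rule ccontr)
    assume "S \<inter> G \<inter> {0..1} \<noteq> {}"
    then obtain \<theta> where "\<theta> \<in> S" "\<theta> \<in> G" by auto
    then obtain s where s: "\<theta> \<in> {0..1}" "Im s \<ge> 0" "F \<theta> s = 0" "norm (ceval p b) * Im s ^ d \<le> norm (F \<theta> s)"
      by (auto simp: S_def G_def)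
    show False
    proof (cases "Im s = 0")
      case True
      then have "s = of_real (Re s)" by (simp add: complex_eq_iff)
      then show False using noreal[OF s(1), of "Re s"] s(3) by (simp add: F_def)
    next
      case False
      then have "norm (ceval p b) * Im s ^ d > 0" using s(2) b by simp
      then show False using s by simp
    qed
  qed
  moreover have "{0..1} \<subseteq> S \<union> G"
  proof
    fix \<theta> :: real assume \<theta>: "\<theta> \<in> {0..1}"
    show "\<theta> \<in> S \<union> G"
    proof (cases "\<theta> \<in> S")
      case False
      define P where "P = cline p (Z \<theta>) b"
      have P: "poly P s = F \<theta> s" for s by (simp add: P_def poly_cline F_def)
      have deg: "degree P \<le> d" "coeff P d = ceval p b"
        unfolding P_def cline_def ceval_def by (rule rpsubst_line[OF hom])+
      \<comment> \<open>The top coefficient is \<open>ceval p b\<close> for every parameter, so the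
        lower bound holds with the same constant throughout the homotopy.\<close>
      have "degree P = d" using deg b le_antisym le_degree by metis
      have "P \<noteq> 0" using deg b by auto
      moreover have "Im s < 0" if "poly P s = 0" for s
      proof (rule ccontr)
        assume "\<not> Im s < 0"
        then have "\<theta> \<in> S" using that \<theta> unfolding S_def P mem_Collect_eq by (meson not_le)
        with False show False by contradiction
      qed
      ultimately have "\<forall>s. Im s \<ge> 0 \<longrightarrow> norm (lead_coeff P) * Im s ^ degree P \<le> norm (poly P s)"
        using lower_half_plane_roots by blast
      then have "\<forall>s. Im s \<ge> 0 \<longrightarrow> norm (ceval p b) * Im s ^ d \<le> norm (F \<theta> s)"
        by (simp only: \<open>degree P = d\<close> deg P)
      then show ?thesis using \<theta> by (simp add: G_def)
    qed simp
  qed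
  ultimately have "S \<inter> {0..1} = {} \<or> G \<inter> {0..1} = {}"
    using connected_closedD[OF connected_Icc[of "0::real" 1]] \<open>closed S\<close> \<open>closed G\<close> by blast
  \<comment> \<open>By connectedness one of \<open>S\<close> and \<open>G\<close> misses the
    interval; the starting parameter lies in \<open>G\<close>, so it must be
    \<open>S\<close>.\<close>
  moreover have "0 \<in> G"
  proof -
    have "0 \<notin> S" using start by (auto simp: S_def F_def)
    moreover have "0 \<in> S \<union> G" using \<open>{0..1} \<subseteq> S \<union> G\<close> by (rule subsetD) simp
    ultimately show ?thesis by blast
  qed
  ultimately have "1 \<notin> S" by fastforce
  then show ?thesis using assms(6) by (auto simp: S_def F_def)
qed

text \<open>Shrink \<open>x + \<i> w\<close> to 0 while keeping \<open>\<i> \<alpha> e\<close>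
  fixed. At the start the zeros in \<open>r\<close> can be located by hyperbolicity alone, and real
  zeros are excluded throughout because \<open>w\<close> is tubular. Allowing \<open>t = 0\<close>
  in the condition on \<open>b\<close> gives the nonzero leading coefficient required by the
  homotopy.\<close>

lemma cone_shift_strict:
  fixes x w e b :: "nat \<Rightarrow> real"
  assumes hom: "homogeneous d p"
    and hyp: "\<And>x \<tau>. Im \<tau> \<noteq> 0 \<Longrightarrow> ceval p (\<lambda>i. of_real (x i) + \<tau> * of_real (e i)) \<noteq> 0"
    and w: "\<And>x \<alpha>. \<alpha> > 0 \<Longrightarrow> ceval p (\<lambda>i. of_real (x i) + \<i> * of_real (w i + \<alpha> * e i)) \<noteq> 0"
    and b: "\<And>t. t \<ge> 0 \<Longrightarrow> ceval p (\<lambda>i. of_real (b i + t * e i)) \<noteq> 0"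
    and "\<alpha> > 0" "Im r \<ge> 0"
  shows "ceval p (\<lambda>i. of_real (x i) + \<i> * of_real (w i + \<alpha> * e i) + r * of_real (b i)) \<noteq> 0"
proof -
  define Z where "Z = (\<lambda>\<theta> i. of_real \<theta> * (of_real (x i) + \<i> * of_real (w i)) + \<i> * of_real (\<alpha> * e i))"
  have hyp0: "ceval p (\<lambda>i. \<i> * of_real (\<alpha> * e i) + of_real r * of_real (b i)) \<noteq> 0" for r :: real
    using hyp[of "\<i> * of_real \<alpha>" "\<lambda>i. r * b i"] \<open>\<alpha> > 0\<close> by (simp add: add.commute mult_ac)
  have "ceval p (\<lambda>i. Z 1 i + r * of_real (b i)) \<noteq> 0"
  proof (rule upper_half_plane_homotopy[OF hom])
    show "ceval p (\<lambda>i. of_real (b i)) \<noteq> 0" using b[of 0] by simp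
    show "continuous_on UNIV (\<lambda>\<theta>. Z \<theta> i)" for i unfolding Z_def by (intro continuous_intros)
    fix \<theta> r :: real assume \<theta>: "\<theta> \<in> {0..1}"
    show "ceval p (\<lambda>i. Z \<theta> i + of_real r * of_real (b i)) \<noteq> 0"
    proof (cases "\<theta> = 0")
      case True
      then show ?thesis using hyp0 by (simp add: Z_def)
    next
      case False
      then have "\<theta> > 0" using \<theta> by simp
      \<comment> \<open>After division by \<open>\<theta>\<close> the real shift along
        \<open>b\<close> is absorbed in the real part and \<open>\<alpha>\<close> becomes
        \<open>\<alpha> / \<theta>\<close>, so the point lies in the tube over
        \<open>w\<close>.\<close>
      have "(\<lambda>i. Z \<theta> i + of_real r * of_real (b i)) = (\<lambda>i. of_real \<theta> *
         (of_real (x i + r / \<theta> * b i) + \<i> * of_real (w i + (\<alpha> / \<theta>) * e i)))"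
        using False by (auto simp: Z_def complex_eq_iff field_simps)
      moreover have "\<alpha> / \<theta> > 0" using \<open>\<alpha> > 0\<close> \<open>\<theta> > 0\<close> by simp
      ultimately show ?thesis
        using w[of "\<alpha> / \<theta>" "\<lambda>i. x i + r / \<theta> * b i"] False by (simp only: ceval_scale[OF hom]) auto
    qed
  next
    fix r :: complex assume r: "Im r \<ge> 0"
    show "ceval p (\<lambda>i. Z 0 i + r * of_real (b i)) \<noteq> 0"
    proof
      assume "ceval p (\<lambda>i. Z 0 i + r * of_real (b i)) = 0"
      then have z: "ceval p (\<lambda>i. \<i> * of_real (\<alpha> * e i) + r * of_real (b i)) = 0" by (simp add: Z_def)
      then have "r \<noteq> 0" using hyp0[of 0] by auto
      \<comment> \<open>Dividing by \<open>r\<close> makes \<open>\<tau>\<close> a zero of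
        \<open>p (b + \<tau> e)\<close>, hence real by hyperbolicity. Its real part is
        \<open>\<alpha> * Im r\<close> divided by the squared norm of \<open>r\<close>, so it is
        nonnegative, contrary to the condition on \<open>b\<close>.\<close>
      define \<tau> where "\<tau> = \<i> * of_real \<alpha> / r"
      have "(\<lambda>i. \<i> * of_real (\<alpha> * e i) + r * of_real (b i)) = (\<lambda>i. r * (of_real (b i) + \<tau> * of_real (e i)))"
        using \<open>r \<noteq> 0\<close> by (auto simp: \<tau>_def distrib_left)
      with z have \<tau>: "ceval p (\<lambda>i. of_real (b i) + \<tau> * of_real (e i)) = 0"
        using ceval_scale[OF hom] \<open>r \<noteq> 0\<close> by (metis mult_eq_0_iff power_not_zero)
      then have "Im \<tau> = 0" using hyp by blast
      then have "\<tau> = of_real (Re \<tau>)" by (simp add: complex_eq_iff)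
      with \<tau> have "ceval p (\<lambda>i. of_real (b i + Re \<tau> * e i)) = 0" by simp
      moreover have "Re \<tau> \<ge> 0" using r \<open>\<alpha> > 0\<close> by (simp add: \<tau>_def Re_divide')
      ultimately show False using b by blast
    qed
  qed fact
  then show ?thesis by (simp add: Z_def algebra_simps)
qed

text \<open>On the boundary of the cone \<open>p\<close> may vanish at \<open>b\<close>. Replacing
  \<open>b\<close> by \<open>b + t e\<close> with \<open>t > 0\<close> restores the strict case, and
  the surplus multiple of \<open>e\<close> is taken from \<open>\<alpha> e\<close>.\<close>

lemma cone_shift:
  fixes x w e b :: "nat \<Rightarrow> real"
  assumes hom: "homogeneous d p"
    and hyp: "\<And>x \<tau>. Im \<tau> \<noteq> 0 \<Longrightarrow> ceval p (\<lambda>i. of_real (x i) + \<tau> * of_real (e i)) \<noteq> 0"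
    and w: "\<And>x \<alpha>. \<alpha> > 0 \<Longrightarrow> ceval p (\<lambda>i. of_real (x i) + \<i> * of_real (w i + \<alpha> * e i)) \<noteq> 0"
    and b: "\<And>t. t > 0 \<Longrightarrow> ceval p (\<lambda>i. of_real (b i + t * e i)) \<noteq> 0"
    and "\<alpha> > 0" "\<sigma> \<ge> 0"
  shows "ceval p (\<lambda>i. of_real (x i) + \<i> * of_real (w i + \<sigma> * b i + \<alpha> * e i)) \<noteq> 0"
proof (cases "\<sigma> = 0")
  case True
  then show ?thesis using w[OF \<open>\<alpha> > 0\<close>] by simp
next
  case False
  \<comment> \<open>Chosen so that the shift by \<open>\<sigma>\<close> times \<open>t e\<close>
    uses up exactly half of \<open>\<alpha> e\<close>; the other half keeps the point in the tube
    over \<open>w\<close>.\<close>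
  define t where "t = \<alpha> / (2 * \<sigma>)"
  have t: "t > 0" "\<sigma> * t = \<alpha> / 2" using False assms by (auto simp: t_def)
  have b': "ceval p (\<lambda>i. of_real (b i + t * e i + s * e i)) \<noteq> 0" if "s \<ge> 0" for s
    using b[of "t + s"] t that by (simp add: algebra_simps)
  have "ceval p (\<lambda>i. of_real (x i) + \<i> * of_real (w i + (\<alpha> / 2) * e i) + (\<i> * of_real \<sigma>) * of_real (b i + t * e i)) \<noteq> 0"
    by (rule cone_shift_strict[OF hom hyp w]) (use b' assms in auto)
  moreover have "of_real (x i) + \<i> * of_real (w i + (\<alpha> / 2) * e i) + (\<i> * of_real \<sigma>) * of_real (b i + t * e i)
     = of_real (x i) + \<i> * complex_of_real (w i + \<sigma> * b i + \<alpha> * e i)" for i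
  proof -
    have "w i + (\<alpha> / 2) * e i + \<sigma> * (b i + t * e i) = w i + (\<alpha> / 2) * e i + \<sigma> * b i + (\<sigma> * t) * e i"
      by (simp add: algebra_simps)
    also have "\<dots> = w i + \<sigma> * b i + \<alpha> * e i" unfolding t by (simp add: algebra_simps)
    finally show ?thesis by (simp add: complex_eq_iff)
  qed
  ultimately show ?thesis by (simp only: not_False_eq_True)
qed

subsection \<open>Hyperbolicity cones\<close>

lemma ceval_line_poly:
  "ceval h (\<lambda>i. of_real (s * e $ i - x $ i)) = of_real (poly (line_poly h e x) s)"
proof -
  have "poly (line_poly h e x) s = rpsubst (\<lambda>a. a) (\<lambda>i. - (x $ i) + s * e $ i) h"
    unfolding line_poly_def by (rule poly_rpsubst_line)
  then show ?thesis by (simp add: ceval_of_real[symmetric] add.commute)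
qed

lemma hyp_eigenvalue_iff:
  assumes "homogeneous d h" "rpeval h e \<noteq> 0"
  shows "l \<in># hyp_eigenvalues h e x \<longleftrightarrow> ceval h (\<lambda>i. of_real (l * e $ i - x $ i)) = 0"
proof -
  \<comment> \<open>\<open>proots\<close> of the zero polynomial is empty by convention, so roots
    and eigenvalues agree only once the line polynomial is known to be nonzero.\<close>
  have "coeff (line_poly h e x) d = rpeval h e"
    unfolding line_poly_def rpeval_def by (rule rpsubst_line(2)[OF assms(1)])
  then have "line_poly h e x \<noteq> 0" using assms(2) by auto
  then show ?thesis unfolding ceval_line_poly by (simp add: hyp_eigenvalues_def)
qed

text \<open>Eigenvalues are defined through \<open>t e - x\<close>, whereas the tube arguments use
  \<open>x + t e\<close>; homogeneity pulls out the factor -1 between the two.\<close>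

lemma hyp_eigenvalue_uminus:
  assumes "homogeneous d h" "rpeval h e \<noteq> 0" "ceval h (\<lambda>i. of_real (x $ i + t * e $ i)) = 0"
  shows "- t \<in># hyp_eigenvalues h e x"
proof -
  have "ceval h (\<lambda>i. (-1) * of_real (x $ i + t * e $ i)) = 0"
    unfolding ceval_scale[OF assms(1)] using assms(3) by simp
  also have "(\<lambda>i. (-1) * of_real (x $ i + t * e $ i)) = (\<lambda>i. complex_of_real ((- t) * e $ i - x $ i))"
    by (auto simp: complex_eq_iff)
  finally show ?thesis unfolding hyp_eigenvalue_iff[OF assms(1,2)] .
qed

lemma hyperbolic_ceval_nonzero:
  assumes "hyperbolic n h e" "Im \<tau> \<noteq> 0"
  shows "ceval h (\<lambda>i. of_real (x i) + \<tau> * of_real (e $ i)) \<noteq> 0"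
proof
  assume "ceval h (\<lambda>i. of_real (x i) + \<tau> * of_real (e $ i)) = 0"
  moreover have "ceval h (\<lambda>i. of_real (x i) + \<tau> * of_real (e $ i))
     = ceval h (\<lambda>i. \<tau> * of_real (e $ i) - of_real (vec n (\<lambda>i. - x i) $ i))"
    by (rule ceval_cong[of _ n]) (use assms in \<open>auto simp: hyperbolic_def\<close>)
  ultimately have "\<tau> \<in> \<real>"
    using assms(1) unfolding hyperbolic_def poly_map_line_poly by (metis vec_carrier)
  then show False using assms(2) by (simp add: complex_is_Real_iff)
qed

text \<open>
  Membership in \<open>tube_cone h e\<close> is what the induction over the factors of the mixed polynomial
  needs: it is preserved by adding elements of the closed cone, and it gives nonvanishing directly,
  so convexity of the hyperbolicity cone never has to be proved.
\<close>

definition tube_cone :: "rpoly \<Rightarrow> real vec \<Rightarrow> (nat \<Rightarrow> real) set" where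
  "tube_cone h e = {w. \<forall>x \<alpha>. \<alpha> > 0 \<longrightarrow>
     ceval h (\<lambda>i. of_real (x i) + \<i> * of_real (w i + \<alpha> * e $ i)) \<noteq> 0}"

lemma zero_in_tube_cone:
  assumes "hyperbolic n h e"
  shows "(\<lambda>i. 0) \<in> tube_cone h e"
proof -
  have "ceval h (\<lambda>i. of_real (x i) + \<i> * of_real (0 + \<alpha> * e $ i)) \<noteq> 0" if "\<alpha> > 0" for x \<alpha>
    using hyperbolic_ceval_nonzero[OF assms, of "\<i> * of_real \<alpha>" x] that by (simp add: mult.assoc)
  then show ?thesis by (simp add: tube_cone_def)
qed

lemma tube_cone_add:
  assumes h: "hyperbolic n h e" and w: "w \<in> tube_cone h e" and "\<sigma> \<ge> 0"
    and b: "\<And>t. t > 0 \<Longrightarrow> ceval h (\<lambda>i. of_real (b i + t * e $ i)) \<noteq> 0"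
  shows "(\<lambda>i. w i + \<sigma> * b i) \<in> tube_cone h e"
proof -
  obtain d where "homogeneous d h" using h by (auto simp: hyperbolic_def)
  note shift = cone_shift[OF this hyperbolic_ceval_nonzero[OF h] _ b _ \<open>\<sigma> \<ge> 0\<close>]
  show ?thesis unfolding tube_cone_def mem_Collect_eq
    by (intro allI impI shift) (use w in \<open>auto simp: tube_cone_def\<close>)
qed

lemma closed_hyp_cone_nonzero:
  assumes "hyperbolic n h e" "b \<in> closed_hyp_cone n h e" "t > 0"
  shows "ceval h (\<lambda>i. of_real (b $ i + t * e $ i)) \<noteq> 0"
proof
  assume "ceval h (\<lambda>i. of_real (b $ i + t * e $ i)) = 0"
  then have "- t \<in># hyp_eigenvalues h e b"
    using assms(1) hyp_eigenvalue_uminus by (auto simp: hyperbolic_def)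
  then show False using assms(2,3) by (auto simp: closed_hyp_cone_def)
qed

text \<open>All eigenvalues of \<open>x\<close> are positive, so subtracting a small multiple of
  \<open>e\<close> leaves them nonnegative, and adding the result to the tubular point 0 stays
  tubular. The slack \<open>\<epsilon>\<close> later excludes the eigenvalue 0 of the mixed
  polynomial.\<close>

lemma open_hyp_cone_tube:
  assumes h: "hyperbolic n h e" and x: "x \<in> open_hyp_cone n h e"
  obtains \<epsilon> where "\<epsilon> > 0" "(\<lambda>i. x $ i - \<epsilon> * e $ i) \<in> tube_cone h e"
proof -
  \<comment> \<open>The inserted 1 makes the minimum meaningful when there are no
    eigenvalues.\<close>
  define \<epsilon> where "\<epsilon> = Min (insert 1 (set_mset (hyp_eigenvalues h e x)))"
  have eps: "\<epsilon> \<le> l" if "l \<in># hyp_eigenvalues h e x" for l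
    unfolding \<epsilon>_def using that by (intro Min_le) auto
  have "\<epsilon> > 0" unfolding \<epsilon>_def using x by (subst Min_gr_iff) (auto simp: open_hyp_cone_def)
  have "ceval h (\<lambda>i. of_real ((x $ i - \<epsilon> * e $ i) + t * e $ i)) \<noteq> 0" if "t > 0" for t
  proof
    assume "ceval h (\<lambda>i. of_real ((x $ i - \<epsilon> * e $ i) + t * e $ i)) = 0"
    then have "ceval h (\<lambda>i. of_real (x $ i + (t - \<epsilon>) * e $ i)) = 0"
      by (simp add: algebra_simps)
    then have "- (t - \<epsilon>) \<in># hyp_eigenvalues h e x"
      using h hyp_eigenvalue_uminus unfolding hyperbolic_def by blast
    from eps[OF this] show False using that by simp
  qed
  from tube_cone_add[OF h zero_in_tube_cone[OF h], of 1, OF _ this]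
  have "(\<lambda>i. x $ i - \<epsilon> * e $ i) \<in> tube_cone h e" by simp
  with \<open>\<epsilon> > 0\<close> show ?thesis by (rule that)
qed

text \<open>The step uses the induction hypothesis at every \<open>z + r v\<^sub>j\<close> with
  \<open>Im r \<ge> 0\<close>, so \<open>w\<close>, \<open>x\<close> and \<open>z\<close> must vary:
  the real part of the shift goes into \<open>x\<close>, the imaginary part into \<open>w\<close>,
  and the y-coordinates are unchanged.\<close>

lemma mixed_factors_nonzero:
  assumes h: "hyperbolic n h e"
    and v: "\<And>j. j < m \<Longrightarrow> v j \<in> closed_hyp_cone n h e"
    and "set js \<subseteq> {..<m}"
    and "w \<in> tube_cone h e" "\<alpha> > 0"
    and "\<And>i. i < n \<Longrightarrow> z i = of_real (x i) + \<i> * of_real (w i + \<alpha> * e $ i)"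
    and "\<And>j. j < m \<Longrightarrow> Im (z (n + j)) \<le> 0"
  shows "ceval (foldr (\<lambda>j g. g - rpvar (n + j) * dir_deriv (v j) g) js h) z \<noteq> 0"
  using assms(3-)
proof (induction js arbitrary: w x z)
  case Nil
  have "ceval h z = ceval h (\<lambda>i. of_real (x i) + \<i> * of_real (w i + \<alpha> * e $ i))"
    by (rule ceval_cong[of _ n]) (use h Nil in \<open>auto simp: hyperbolic_def\<close>)
  then show ?case using Nil by (simp add: tube_cone_def)
next
  case (Cons j js)
  define g where "g = foldr (\<lambda>j g. g - rpvar (n + j) * dir_deriv (v j) g) js h"
  define b where "b = (\<lambda>i. if i < n then complex_of_real (v j $ i) else 0)"
  have j: "j < m" using Cons.prems by simp
  then have vj: "v j \<in> closed_hyp_cone n h e" by (rule v)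
  have P: "poly (cline g z b) r \<noteq> 0" if "Im r \<ge> 0" for r
    unfolding poly_cline g_def
  proof (rule Cons.IH[where w = "\<lambda>i. w i + Im r * v j $ i" and x = "\<lambda>i. x i + Re r * v j $ i"])
    show "(\<lambda>i. w i + Im r * v j $ i) \<in> tube_cone h e"
      by (rule tube_cone_add[OF h Cons.prems(2) that]) (rule closed_hyp_cone_nonzero[OF h vj])
  qed (use Cons.prems in \<open>auto simp: b_def complex_eq_iff algebra_simps\<close>)
  have "poly (cline g z b) 0 - z (n + j) * poly (pderiv (cline g z b)) 0 \<noteq> 0"
    by (rule minus_pderiv_nonzero[OF P Cons.prems(5)[OF j]])
  moreover have "poly (pderiv (cline g z b)) 0 = ceval (dir_deriv (v j) g) z"
    unfolding b_def by (rule poly_pderiv_cline) (use vj in \<open>simp add: closed_hyp_cone_def\<close>)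
  ultimately have "ceval (g - rpvar (n + j) * dir_deriv (v j) g) z \<noteq> 0"
    by (simp add: ceval_diff ceval_rpvar_mult poly_cline)
  then show ?case by (simp add: g_def)
qed

lemma mixed_factors_homogeneous:
  fixes v :: "nat \<Rightarrow> real vec"
  assumes "homogeneous d h" "h \<in> polys_in n" "set js \<subseteq> {..<m}"
  defines "g \<equiv> foldr (\<lambda>j g. g - rpvar (n + j) * dir_deriv (v j) g) js h"
  shows "homogeneous d g" "g \<in> polys_in (n + m)"
  using assms(3) unfolding g_def
  by (induction js)
     (auto simp: assms(1) polys_in_mono[OF assms(2)] homogeneous_diff homogeneous_rpvar_dir_deriv
        polys_in_diff polys_in_rpvar_dir_deriv)

theorem theorem3p3:
  fixes n m :: nat and h :: rpoly and e :: "real vec" and v :: "nat \<Rightarrow> real vec"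
  assumes "hyperbolic n h e"
    and "\<And>j. j < m \<Longrightarrow> v j \<in> closed_hyp_cone n h e"
  shows "hyperbolic (n + m) (mixed_hyp_poly n m v h) (e @\<^sub>v 0\<^sub>v m)
    \<and> {x @\<^sub>v y | x y. x \<in> open_hyp_cone n h e \<and> y \<in> carrier_vec m \<and> (\<forall>j<m. y $ j \<le> 0)}
        \<subseteq> open_hyp_cone (n + m) (mixed_hyp_poly n m v h) (e @\<^sub>v 0\<^sub>v m)"
proof -
  define H where "H = mixed_hyp_poly n m v h"
  define E where "E = e @\<^sub>v 0\<^sub>v m"
  obtain d where d: "homogeneous d h" using assms(1) by (auto simp: hyperbolic_def)
  have hn: "h \<in> polys_in n" and en: "e \<in> carrier_vec n" using assms(1) by (auto simp: hyperbolic_def)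
  have idx: "set [0..<m] \<subseteq> {..<m}" by auto
  note H = mixed_factors_homogeneous[OF d hn idx, of v, folded mixed_hyp_poly_def H_def]
  have nonzero: "ceval H z \<noteq> 0"
    if "w \<in> tube_cone h e" "\<alpha> > 0"
      "\<And>i. i < n \<Longrightarrow> z i = of_real (x i) + \<i> * of_real (w i + \<alpha> * e $ i)"
      "\<And>j. j < m \<Longrightarrow> Im (z (n + j)) \<le> 0" for w \<alpha> x z
    unfolding H_def mixed_hyp_poly_def
    by (rule mixed_factors_nonzero[OF assms(1) _ idx that]) (rule assms(2))
  have E: "E \<in> carrier_vec (n + m)" "\<And>i. i < n \<Longrightarrow> E $ i = e $ i" "\<And>j. j < m \<Longrightarrow> E $ (n + j) = 0"
    using en by (auto simp: E_def)
  \<comment> \<open>The point \<open>\<i> E\<close> lies in the tube over 0; homogeneity then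
    removes the factor \<open>\<i>\<close>.\<close>
  have "ceval H (\<lambda>i. \<i> * of_real (E $ i)) \<noteq> 0"
    by (rule nonzero[OF zero_in_tube_cone[OF assms(1)], where \<alpha> = 1 and x = "\<lambda>i. 0"]) (auto simp: E)
  then have "ceval H (\<lambda>i. of_real (E $ i)) \<noteq> 0" unfolding ceval_scale[OF H(1)] by auto
  then have HE: "rpeval H E \<noteq> 0" by (simp add: ceval_of_real rpeval_def)
  have upper: "ceval H (\<lambda>i. z * of_real (E $ i) - of_real (X $ i)) \<noteq> 0" if "Im z > 0" for z X
    by (rule nonzero[OF zero_in_tube_cone[OF assms(1)] that, where x = "\<lambda>i. Re z * e $ i - X $ i"])
       (auto simp: E complex_eq_iff)
  have "z \<in> \<real>" if z: "ceval H (\<lambda>i. z * of_real (E $ i) - of_real (X $ i)) = 0" for z X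
  proof -
    \<comment> \<open>The coefficients of \<open>H\<close> are real, so conjugation reduces zeros in
      the lower half-plane to those in the upper one.\<close>
    have "ceval H (\<lambda>i. cnj z * of_real (E $ i) - of_real (X $ i)) = 0"
      using z ceval_cnj[of H "\<lambda>i. z * of_real (E $ i) - of_real (X $ i)"] by simp
    then show ?thesis
      using upper[of z X] upper[of "cnj z" X] z by (force simp: complex_is_Real_iff)
  qed
  then have hyp: "hyperbolic (n + m) H E"
    unfolding hyperbolic_def poly_map_line_poly using H E(1) HE by auto
  have "x @\<^sub>v y \<in> open_hyp_cone (n + m) H E"
    if x: "x \<in> open_hyp_cone n h e" and y: "y \<in> carrier_vec m" "\<forall>j<m. y $ j \<le> 0" for x y
  proof -
    define X where "X = x @\<^sub>v y"
    have xn: "x \<in> carrier_vec n" using x by (simp add: open_hyp_cone_def)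
    have X: "X \<in> carrier_vec (n + m)" "\<And>i. i < n \<Longrightarrow> X $ i = x $ i" "\<And>j. j < m \<Longrightarrow> X $ (n + j) = y $ j"
      using xn y by (auto simp: X_def)
    obtain \<epsilon> where eps: "\<epsilon> > 0" "(\<lambda>i. x $ i - \<epsilon> * e $ i) \<in> tube_cone h e"
      using open_hyp_cone_tube[OF assms(1) x] by blast
    have "l > 0" if "l \<in># hyp_eigenvalues H E X" for l
    proof (rule ccontr)
      assume "\<not> l > 0"
      then have pos: "\<epsilon> - l > 0" using eps by simp
      \<comment> \<open>Multiplied by \<open>- \<i>\<close>, the x-part of \<open>l E - X\<close> is
        \<open>\<i>\<close> times \<open>(x - \<epsilon> e) + (\<epsilon> - l) e\<close>, a point of
        the tube. The y-part becomes \<open>\<i> y\<close>, whose imaginary parts are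
        nonpositive.\<close>
      have "ceval H (\<lambda>i. - \<i> * of_real (l * E $ i - X $ i)) \<noteq> 0"
        by (rule nonzero[OF eps(2) pos, where x = "\<lambda>i. 0"])
           (use y in \<open>auto simp: E X complex_eq_iff left_diff_distrib\<close>)
      then show False
        using that unfolding hyp_eigenvalue_iff[OF H(1) HE] ceval_scale[OF H(1)] by simp
    qed
    then show ?thesis using X(1) by (simp add: open_hyp_cone_def X_def)
  qed
  with hyp show ?thesis unfolding H_def E_def by blast
qed

end
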